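(* In the curved $4$-body problem in $\mathbb S^2$, there are no trapezoidal relative equilibria generated from fixed points (with the trapezoid inscribed in a great circle) if the masses on each of the parallel sides are equal, i.e. if $m_1=m_2>0$ and $m_3=m_4>0$, where the parallel sides are the chord joining ${\bf q}_1$ and ${\bf q}_2$ and the chord joining ${\bf q}_3$ and ${\bf q}_4$.
   Context: $\mathbb S^2=\{(x,y,z)\in\mathbb R^3 : x^2+y^2+z^2=1\}$, and $\cdot$ is the standard inner product of $\mathbb R^3$. The curved $4$-body problem in $\mathbb S^2$ describes the motion of bodies of masses $m_1,m_2,m_3,m_4>0$ with position vectors ${\bf q}_i\in\mathbb S^2$ through the equations $$\ddot{\bf q}_i=\sum_{j=1,\,j\ne i}^4\frac{m_j[{\bf q}_j-({\bf q}_i\cdot{\bf q}_j){\bf q}_i]}{[1-({\bf q}_i\cdot{\bf q}_j)^2]^{3/2}}-(\dot{\bf q}_i\cdot\dot{\bf q}_i){\bf q}_i,\qquad i=1,2,3,4,$$ with initial constraints $({\bf q}_i\cdot{\bf q}_i)(0)=1$, $({\bf q}_i\cdot\dot{\bf q}_i)(0)=0$. The equations are undefined (singular) if two bodies coincide or are antipodal, so such configurations are excluded. A fixed point is a static solution, i.e. a nonsingular configuration for which $\ddot{\bf q}_i(0)=\dot{\bf q}_i(0)={\bf 0}$ for $i=1,2,3,4$. A relative equilibrium is a solution along which all mutual distances between the bodies remain constant. It is generated from a fixed point if it is obtained by giving a rotation to the particle system whose initial configuration $({\bf q}_1(0),{\bf q}_2(0),{\bf q}_3(0),{\bf q}_4(0))$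 is that of a fixed point. It is trapezoidal if the bodies lie on a great circle of $\mathbb S^2$ and are the vertices of a Euclidean trapezoid in the plane of that great circle. *)

theory Defs
  imports "HOL-Analysis.Analysis"
begin

text \<open>
  The four bodies are indexed by the four-element type \<open>4\<close> (whose elements are
  \<open>1, 2, 3\<close> and \<open>4 = 0\<close>), and a motion is a map \<open>q\<close> such that \<open>q i t\<close> is the
  position of body \<open>i\<close> at time \<open>t\<close>.
\<close>

abbreviation S2 :: "(real^3) set" where
  "S2 \<equiv> sphere 0 1"

definition nonsingular :: "(4 \<Rightarrow> real^3) \<Rightarrow> bool" where
  "nonsingular x \<longleftrightarrow> (\<forall>i j. i \<noteq> j \<longrightarrow> x i \<noteq> x j \<and> x i \<noteq> - x j)"

definition velocity :: "(4 \<Rightarrow> real \<Rightarrow> real^3) \<Rightarrow> 4 \<Rightarrow> real \<Rightarrow> real^3" where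
  "velocity q i t = vector_derivative (q i) (at t)"

definition acceleration :: "(4 \<Rightarrow> real \<Rightarrow> real^3) \<Rightarrow> 4 \<Rightarrow> real \<Rightarrow> real^3" where
  "acceleration q i t = vector_derivative (velocity q i) (at t)"

text \<open>Right-hand side of the equations of motion at positions \<open>x\<close> and velocities \<open>v\<close>.\<close>

definition curved_rhs ::
    "(4 \<Rightarrow> real) \<Rightarrow> (4 \<Rightarrow> real^3) \<Rightarrow> (4 \<Rightarrow> real^3) \<Rightarrow> 4 \<Rightarrow> real^3" where
  "curved_rhs m x v i =
     (\<Sum>j\<in>UNIV - {i}. (m j / (1 - (x i \<bullet> x j)\<^sup>2) powr (3/2)) *\<^sub>R (x j - (x i \<bullet> x j) *\<^sub>R x i))
     - (v i \<bullet> v i) *\<^sub>R x i"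

text \<open>
  Since \<open>vector_derivative\<close> is a choice operator, twice differentiability is demanded
  through \<open>has_vector_derivative\<close>.
\<close>

definition curved_solution ::
    "(4 \<Rightarrow> real) \<Rightarrow> real set \<Rightarrow> (4 \<Rightarrow> real \<Rightarrow> real^3) \<Rightarrow> bool" where
  "curved_solution m J q \<longleftrightarrow>
     open J \<and> is_interval J \<and> 0 \<in> J \<and>
     (\<forall>t\<in>J. (\<forall>i. q i t \<in> S2) \<and> nonsingular (\<lambda>i. q i t)) \<and>
     (\<forall>i. q i 0 \<bullet> q i 0 = 1 \<and> q i 0 \<bullet> velocity q i 0 = 0) \<and>
     (\<forall>t\<in>J. \<forall>i.
        (q i has_vector_derivative velocity q i t) (at t) \<and>
        (velocity q i has_vector_derivative
           curved_rhs m (\<lambda>k. q k t) (\<lambda>k. velocity q k t) i) (at t))"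

definition fixed_point ::
    "(4 \<Rightarrow> real) \<Rightarrow> real set \<Rightarrow> (4 \<Rightarrow> real \<Rightarrow> real^3) \<Rightarrow> bool" where
  "fixed_point m J p \<longleftrightarrow>
     curved_solution m J p \<and> (\<forall>i. velocity p i 0 = 0 \<and> acceleration p i 0 = 0)"

text \<open>
  On the sphere, constancy of the Euclidean distance is the same as constancy of the
  geodesic distance \<open>arccos (q i t \<bullet> q j t)\<close>.
\<close>

definition relative_equilibrium ::
    "(4 \<Rightarrow> real) \<Rightarrow> real set \<Rightarrow> (4 \<Rightarrow> real \<Rightarrow> real^3) \<Rightarrow> bool" where
  "relative_equilibrium m J q \<longleftrightarrow>
     curved_solution m J q \<and>
     (\<forall>i j. (\<lambda>t. dist (q i t) (q j t)) constant_on J)"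

text \<open>
  The rotation may depend on time in an arbitrary way; uniform rotations about a fixed
  axis are a special case.
\<close>

definition generated_from_fixed_point ::
    "(4 \<Rightarrow> real) \<Rightarrow> real set \<Rightarrow> (4 \<Rightarrow> real \<Rightarrow> real^3) \<Rightarrow> bool" where
  "generated_from_fixed_point m J q \<longleftrightarrow>
     (\<exists>I p. fixed_point m I p \<and> (\<forall>i. q i 0 = p i 0)) \<and>
     (\<exists>R :: real \<Rightarrow> real^3^3. \<forall>t\<in>J. rotation_matrix (R t) \<and> (\<forall>i. q i t = R t *v q i 0))"

definition great_circle :: "(real^3) set \<Rightarrow> bool" where
  "great_circle C \<longleftrightarrow> (\<exists>n. n \<noteq> 0 \<and> C = {x \<in> S2. n \<bullet> x = 0})"

text \<open>
  Points \<open>a, b, c, d\<close> are the vertices of a trapezoid with parallel sides \<open>ab\<close> and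
  \<open>cd\<close>, which lie on distinct parallel lines. The cyclic order of the vertices is
  \<open>a, b, c, d\<close> or \<open>a, b, d, c\<close> according to the sign of \<open>k\<close>. Parallelograms are not
  excluded; those inscribed in a great circle are rectangles, which have antipodal
  vertices.
\<close>

definition trapezoid :: "'a::real_vector \<Rightarrow> 'a \<Rightarrow> 'a \<Rightarrow> 'a \<Rightarrow> bool" where
  "trapezoid a b c d \<longleftrightarrow>
     \<not> collinear {a, b, c} \<and> (\<exists>k. k \<noteq> 0 \<and> d - c = k *\<^sub>R (b - a))"

definition trapezoidal :: "real set \<Rightarrow> (4 \<Rightarrow> real \<Rightarrow> real^3) \<Rightarrow> bool" where
  "trapezoidal J q \<longleftrightarrow>
     (\<forall>t\<in>J. (\<exists>C. great_circle C \<and> (\<forall>i. q i t \<in> C)) \<and>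
            trapezoid (q 1 t) (q 2 t) (q 3 t) (q 4 t))"

end

theory Submission
  imports Defs
begin

text \<open>
  In the plane of the great circle take the axis of symmetry of the (isosceles) trapezoid as second
  coordinate axis, so that the bodies sit at \<open>(-x, y), (x, y), (-z, s), (z, s)\<close>. At a fixed point the
  tangential force on each body vanishes, and a body at signed sine \<open>D\<close> pulls with strength
  \<open>D / \<bar>D\<bar>^3\<close>, written \<open>pull D\<close>. With \<open>A = 2xy\<close>, \<open>B = 2zs\<close>, \<open>U = zy + xs\<close>, \<open>V = zy - xs\<close> the equations
  for the second and fourth body multiply to \<open>pull A * pull B = (pull U)^2 - (pull V)^2 = 1/U^4 - 1/V^4\<close>. But
  \<open>U^2 - V^2 = A * B\<close>, so the two sides have opposite signs.
\<close>

text \<open>At \<open>0\<close> division by zero gives the value \<open>0\<close>, so a body exerts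
  no pull on itself and the force sums may run over all bodies.\<close>

definition pull :: "real \<Rightarrow> real" where
  "pull t = t / \<bar>t\<bar> ^ 3"

lemma pull_minus [simp]: "pull (- t) = - pull t"
  by (simp add: pull_def)

lemma pull_square: "(pull t)\<^sup>2 = 1 / t ^ 4"
proof (cases "t = 0")
  case False
  have "\<bar>t\<bar> ^ 6 = t ^ 6"
    by (simp add: power_even_abs)
  then show ?thesis
    using False by (simp add: pull_def power_divide field_simps flip: power_mult)
qed (simp add: pull_def)

lemma pull_mult: "pull (a * b) = pull a * pull b"
  by (simp add: pull_def abs_mult power_mult_distrib)

lemma pull_pos_iff: "pull t > 0 \<longleftrightarrow> t > 0"
  by (auto simp: pull_def zero_less_divide_iff)

lemma pull_mult_pos_iff: "pull a * pull b > 0 \<longleftrightarrow> a * b > 0"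
  by (simp add: pull_pos_iff flip: pull_mult)

lemma pull_system_inconsistent:
  fixes A B U V \<mu> M :: real
  assumes pos: "\<mu> > 0" "M > 0" and nz: "A \<noteq> 0" "B \<noteq> 0" "U \<noteq> 0" "V \<noteq> 0"
    and eqA: "\<mu> * pull A = M * (pull V - pull U)"
    and eqB: "M * pull B = - \<mu> * (pull V + pull U)"
    and rel: "U\<^sup>2 - V\<^sup>2 = A * B"
  shows False
proof -
  have "(\<mu> * M) * (pull A * pull B) = (\<mu> * pull A) * (M * pull B)"
    by simp
  also have "\<dots> = (\<mu> * M) * ((pull U)\<^sup>2 - (pull V)\<^sup>2)"
    unfolding eqA eqB by (simp add: algebra_simps power2_eq_square)
  finally have prod: "pull A * pull B = 1 / U ^ 4 - 1 / V ^ 4"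
    using pos by (simp add: pull_square)
  \<comment> \<open>The signs of \<open>U\<close> and \<open>V\<close> are unknown, so fourth powers
    are compared as squares of nonnegative squares.\<close>
  have pow4: "U ^ 4 = (U\<^sup>2)\<^sup>2" "V ^ 4 = (V\<^sup>2)\<^sup>2"
    by simp_all
  have "A * B \<noteq> 0"
    using nz by simp
  then consider "A * B > 0" | "A * B < 0"
    by linarith
  then show False
  proof cases
    case 1
    then have "V\<^sup>2 < U\<^sup>2"
      using rel by simp
    then have "V ^ 4 < U ^ 4"
      unfolding pow4 by (rule power_strict_mono) simp_all
    then have "1 / U ^ 4 < 1 / V ^ 4"
      using nz by (intro divide_strict_left_mono) auto
    then show False
      using prod 1 pull_mult_pos_iff[of A B] by linarith
  next
    case 2
    then have "U\<^sup>2 < V\<^sup>2"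
      using rel by simp
    then have "U ^ 4 < V ^ 4"
      unfolding pow4 by (rule power_strict_mono) simp_all
    then have "1 / V ^ 4 < 1 / U ^ 4"
      using nz by (intro divide_strict_left_mono) auto
    then show False
      using prod 2 pull_mult_pos_iff[of A B] by linarith
  qed
qed

text \<open>Parseval for the orthonormal basis \<open>w\<close>, \<open>cross3 n w\<close> of the
  plane orthogonal to \<open>n\<close>. Crossing with \<open>w\<close> maps this plane into the line
  of \<open>n\<close>, and the Binet-Cauchy identity evaluates the inner product of two such
  images.\<close>

lemma inner_in_plane:
  fixes n w p q :: "real^3"
  assumes "n \<bullet> n = 1" "w \<bullet> w = 1" "n \<bullet> w = 0" "n \<bullet> p = 0" "n \<bullet> q = 0"
  shows "p \<bullet> q = (p \<bullet> w) * (q \<bullet> w) + (p \<bullet> cross3 n w) * (q \<bullet> cross3 n w)"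
proof -
  have par: "cross3 n (cross3 w v) = 0" if "n \<bullet> v = 0" for v
    using that assms by (simp add: Lagrange)
  have "cross3 n (cross3 w p) \<bullet> cross3 n (cross3 w q)
      = cross3 w p \<bullet> cross3 w q - (n \<bullet> cross3 w q) * (n \<bullet> cross3 w p)"
    by (simp add: dot_cross assms inner_commute)
  then have "cross3 w p \<bullet> cross3 w q = (n \<bullet> cross3 w p) * (n \<bullet> cross3 w q)"
    using par assms by simp
  moreover have "cross3 w p \<bullet> cross3 w q = p \<bullet> q - (w \<bullet> q) * (w \<bullet> p)"
    by (simp add: dot_cross assms inner_commute)
  moreover have "n \<bullet> cross3 w v = v \<bullet> cross3 n w" for v
    by (simp add: cross3_simps)
  ultimately show ?thesis
    by (simp add: inner_commute[of w] algebra_simps)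
qed

text \<open>This is the equality case of Cauchy-Schwarz for unit vectors.\<close>

lemma one_minus_inner_square_nonzero:
  fixes p q :: "'a::real_inner"
  assumes "p \<bullet> p = 1" "q \<bullet> q = 1" "p \<noteq> q" "p \<noteq> - q"
  shows "1 - (p \<bullet> q)\<^sup>2 \<noteq> 0"
proof
  assume "1 - (p \<bullet> q)\<^sup>2 = 0"
  then have "p \<bullet> q = 1 \<or> p \<bullet> q = -1"
    by (simp add: power2_eq_1_iff)
  then show False
    using assms vector_eq[of p q] vector_eq[of p "- q"] by auto
qed

lemma square_powr_three_halves: "(D\<^sup>2) powr (3/2) = \<bar>D::real\<bar> ^ 3"
proof (cases "D = 0")
  case False
  have "(D\<^sup>2) powr (3/2) = (\<bar>D\<bar> powr 2) powr (3/2)"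
    using False by (simp add: powr_numeral)
  also have "\<dots> = \<bar>D\<bar> powr 3"
    by (simp only: powr_powr) simp
  also have "\<dots> = \<bar>D\<bar> ^ 3"
    using False by (simp add: powr_numeral)
  finally show ?thesis .
qed simp

text \<open>The equations of motion provide a genuine derivative of the velocity; by uniqueness it
  is the chosen \<open>acceleration\<close>, which vanishes.\<close>

lemma fixed_point_force_zero:
  assumes "fixed_point m I p"
  shows "curved_rhs m (\<lambda>k. p k 0) (\<lambda>k. 0) i = 0"
proof -
  have "velocity p k 0 = 0" for k
    using assms by (simp add: fixed_point_def)
  moreover have "(velocity p i has_vector_derivative
      curved_rhs m (\<lambda>k. p k 0) (\<lambda>k. velocity p k 0) i) (at 0)"
    using assms by (auto simp: fixed_point_def curved_solution_def)
  ultimately show ?thesis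
    using assms vector_derivative_at by (fastforce simp: fixed_point_def acceleration_def)
qed

text \<open>The added term \<open>j = i\<close> is zero because a unit vector has no component
  tangent to the sphere at itself.\<close>

lemma curved_rhs_static:
  assumes "x i \<bullet> x i = 1"
  shows "curved_rhs m x (\<lambda>k. 0) i =
    (\<Sum>j\<in>UNIV. (m j / (1 - (x i \<bullet> x j)\<^sup>2) powr (3/2)) *\<^sub>R (x j - (x i \<bullet> x j) *\<^sub>R x i))"
  unfolding curved_rhs_def inner_zero_left scaleR_zero_left diff_0_right
  by (rule sum.mono_neutral_left) (auto simp: assms)

theorem corollary1:
  fixes m :: "4 \<Rightarrow> real"
  assumes "m 1 = m 2" and "m 2 > 0"
    and "m 3 = m 4" and "m 4 > 0"
  shows "\<not> (\<exists>J q. relative_equilibrium m J q \<and> generated_from_fixed_point m J q \<and> trapezoidal J q)"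
proof
  assume "\<exists>J q. relative_equilibrium m J q \<and> generated_from_fixed_point m J q \<and> trapezoidal J q"
  then obtain J q where re: "relative_equilibrium m J q"
    and gen: "generated_from_fixed_point m J q" and trap: "trapezoidal J q"
    by blast
  define X where "X = (\<lambda>i. q i 0)"
  have J0: "0 \<in> J" and unit: "X i \<bullet> X i = 1" and ns: "nonsingular X" for i
    using re by (auto simp: relative_equilibrium_def curved_solution_def X_def)
  obtain I p where "fixed_point m I p" and "\<And>i. q i 0 = p i 0"
    using gen by (auto simp: generated_from_fixed_point_def)
  \<comment> \<open>The velocities are those of the fixed point \<open>p\<close>, not of
    \<open>q\<close>, which may be rotating at time \<open>0\<close>.\<close>
  then have force: "curved_rhs m X (\<lambda>k. 0) i = 0" for i
    using fixed_point_force_zero[of m I p i] by (simp add: X_def)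
  obtain n0 where n0: "n0 \<noteq> 0" "\<And>i. n0 \<bullet> X i = 0"
    using trap J0 unfolding trapezoidal_def great_circle_def X_def by blast
  obtain k where ncol: "\<not> collinear {X 1, X 2, X 3}" and k: "k \<noteq> 0" "X 4 - X 3 = k *\<^sub>R (X 2 - X 1)"
    using trap J0 unfolding trapezoidal_def trapezoid_def X_def by blast
  \<comment> \<open>In the plane orthogonal to \<open>n\<close>, \<open>w\<close> points along the
    parallel sides and \<open>e\<close> along the future axis of symmetry.\<close>
  define n where "n = n0 /\<^sub>R norm n0"
  define w where "w = (X 2 - X 1) /\<^sub>R norm (X 2 - X 1)"
  define e where "e = cross3 n w"
  have ne: "X 2 \<noteq> X 1"
    using ncol by auto
  have n: "n \<bullet> n = 1" "\<And>i. n \<bullet> X i = 0"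
    unfolding norm_eq_1[symmetric] using n0 by (simp_all add: n_def)
  have w: "w \<bullet> w = 1" "n \<bullet> w = 0"
    unfolding norm_eq_1[symmetric] using ne n by (simp_all add: w_def inner_diff_right)
  have ew: "e \<bullet> w = 0"
    by (simp add: e_def dot_cross_self)
  have dot: "X i \<bullet> X j = (X i \<bullet> w) * (X j \<bullet> w) + (X i \<bullet> e) * (X j \<bullet> e)" for i j
    unfolding e_def by (intro inner_in_plane n w)
  define x y z s where "x = X 2 \<bullet> w" "y = X 2 \<bullet> e" "z = X 4 \<bullet> w" "s = X 4 \<bullet> e"
  define L where "L = norm (X 2 - X 1)"
  have L: "L \<noteq> 0"
    using ne by (simp add: L_def)
  then have diff: "X 2 - X 1 = L *\<^sub>R w" "X 4 - X 3 = (k * L) *\<^sub>R w"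
    using k by (simp_all add: w_def L_def)
  have "(X 2 - X 1) \<bullet> e = 0" "(X 4 - X 3) \<bullet> e = 0"
    unfolding diff using ew by (simp_all add: inner_commute)
  then have y1: "X 1 \<bullet> e = y" and s3: "X 3 \<bullet> e = s"
    by (simp_all add: x_y_z_s_def inner_diff_left)
  \<comment> \<open>Endpoints of a chord have equal norm, so the chord is orthogonal to their sum.
    Hence both sides are bisected by the \<open>e\<close>-axis.\<close>
  have "(X 2 - X 1) \<bullet> (X 2 + X 1) = 0" "(X 4 - X 3) \<bullet> (X 4 + X 3) = 0"
    using unit by (simp_all add: inner_diff_left inner_add_right
        inner_commute[of "X 1" "X 2"] inner_commute[of "X 3" "X 4"])
  then have "w \<bullet> (X 2 + X 1) = 0" "w \<bullet> (X 4 + X 3) = 0"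
    using L k(1) unfolding diff inner_scaleR_left mult_eq_0_iff by (blast, blast)
  then have x1: "X 1 \<bullet> w = - x" and z3: "X 3 \<bullet> w = - z"
    by (simp_all add: x_y_z_s_def inner_add_left inner_commute[of w] eq_neg_iff_add_eq_0
        add.commute)
  \<comment> \<open>\<open>D i j\<close> is the signed sine of the angle between bodies
    \<open>i\<close> and \<open>j\<close>; \<open>D2\<close> below is Lagrange's identity for unit
    vectors.\<close>
  define D where "D = (\<lambda>i j. (X j \<bullet> w) * (X i \<bullet> e) - (X j \<bullet> e) * (X i \<bullet> w))"
  have on_circle: "(X i \<bullet> w)\<^sup>2 + (X i \<bullet> e)\<^sup>2 = 1" for i
    using dot[of i i] unit[of i] by (simp add: power2_eq_square)
  have D2: "1 - (X i \<bullet> X j)\<^sup>2 = (D i j)\<^sup>2" for i j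
  proof -
    have "(X i \<bullet> X j)\<^sup>2 + (D i j)\<^sup>2 =
        ((X i \<bullet> w)\<^sup>2 + (X i \<bullet> e)\<^sup>2) * ((X j \<bullet> w)\<^sup>2 + (X j \<bullet> e)\<^sup>2)"
      unfolding dot[of i j] D_def by (simp add: power2_eq_square algebra_simps)
    then show ?thesis
      by (simp add: on_circle)
  qed
  have D_nz: "D i j \<noteq> 0" if "i \<noteq> j" for i j
    using one_minus_inner_square_nonzero[OF unit unit, of i j] ns that D2[of i j]
    by (auto simp: nonsingular_def)
  have balance: "(\<Sum>j\<in>UNIV. m j * pull (D i j)) = 0" for i
  proof -
    \<comment> \<open>the unit tangent vector of the great circle at body \<open>i\<close>\<close>
    define T where "T = (X i \<bullet> e) *\<^sub>R w - (X i \<bullet> w) *\<^sub>R e"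
    have "X j \<bullet> T = D i j" for j
      by (simp add: T_def D_def inner_diff_right)
    moreover have "D i i = 0"
      by (simp add: D_def)
    ultimately have "((m j / (1 - (X i \<bullet> X j)\<^sup>2) powr (3/2)) *\<^sub>R (X j - (X i \<bullet> X j) *\<^sub>R X i)) \<bullet> T
        = m j * pull (D i j)" for j
      by (simp add: D2 square_powr_three_halves pull_def inner_diff_left)
    moreover have "curved_rhs m X (\<lambda>k. 0) i \<bullet> T = 0"
      by (simp add: force)
    ultimately show ?thesis
      by (simp add: curved_rhs_static unit inner_sum_left)
  qed
  define A B U V where "A = 2 * x * y" "B = 2 * z * s" "U = z * y + x * s" "V = z * y - x * s"
  note defs = A_B_U_V_def
  have D_vals: "D 2 1 = - A" "D 2 2 = 0" "D 2 3 = - U" "D 2 4 = V"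
    "D 4 1 = - U" "D 4 2 = - V" "D 4 3 = - B" "D 4 4 = 0"
    by (simp_all add: D_def defs x1 y1 z3 s3 flip: x_y_z_s_def)
  have pull_0: "pull 0 = 0"
    by (simp add: pull_def)
  have "A \<noteq> 0" "B \<noteq> 0" "U \<noteq> 0" "V \<noteq> 0"
    using D_nz[of 2 1] D_nz[of 4 3] D_nz[of 2 3] D_nz[of 2 4] by (simp_all add: D_vals)
  \<comment> \<open>Equality of the masses on each parallel side leaves only \<open>m 2\<close> and
    \<open>m 4\<close> in both equations, so that their product has the common factor
    \<open>m 2 * m 4\<close>.\<close>
  moreover have "m 2 * pull A = m 4 * (pull V - pull U)"
    using balance[of 2] assms by (simp add: sum_4 D_vals pull_0 algebra_simps)
  moreover have "m 4 * pull B = - m 2 * (pull V + pull U)"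
    using balance[of 4] assms by (simp add: sum_4 D_vals pull_0 algebra_simps)
  moreover have "U\<^sup>2 - V\<^sup>2 = A * B"
    by (simp add: defs power2_eq_square algebra_simps)
  ultimately show False
    using pull_system_inconsistent[OF assms(2,4)] by blast
qed

end
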